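(* Let $X,Y$ be topological spaces, $A:X\to Y$ continuous, and let $k_X,k_Y$ be continuous, bounded, strictly positive definite kernels on $X$ and $Y$ with native spaces $\mathcal N(X)$ and $\mathcal N(Y)$. Let $\mathcal X=\{x_1,\dots,x_N\}\subset X$ and $\mathcal Y=\{y_1,\dots,y_M\}\subset Y$ be sets of pairwise distinct centers. Assume that $\mathcal K_A\,\mathcal N(Y)\subset\mathcal N(X)$. Then $$\|\mathcal K_A-\widehat{\mathcal K}_A\|_{\mathcal N(Y)\to C_b(X)}\le\|I-S_{\mathcal X}\|_{\mathcal N(X)\to C_b(X)}\,\|\mathcal K_A\|_{\mathcal N(Y)\to\mathcal N(X)}$$ and $$\|\mathcal K_A-\widehat{\mathcal K}_A^{\mathcal Y}\|_{\mathcal N(Y)\to C_b(X)}\le\|I-S_{\mathcal Y}\|_{\mathcal N(Y)\to C_b(Y)}+\|I-S_{\mathcal X}\|_{\mathcal N(X)\to C_b(X)}\,\|\mathcal K_A\|_{V_{\mathcal Y}\to\mathcal N(X)}.$$ In particular, for every $f\in\mathcal N(Y)$, $$\|\mathcal K_Af-\widehat{\mathcal K}_Af\|_\infty\le\|I-S_{\mathcal X}\|_{\mathcal N(X)\to C_b(X)}\,\|\mathcal K_A\|_{\mathcal N(Y)\to\mathcal N(X)}\,\|f\|_{\mathcal N(Y)}$$ and $$\|\mathcal K_Af-\widehat{\mathcal K}_A^{\mathcal Y}f\|_\infty\le\|f-S_{\mathcal Y}f\|_\infty+\|I-S_{\mathcal X}\|_{\mathcal N(X)\to C_b(X)}\,\|\mathcal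 K_A\|_{V_{\mathcal Y}\to\mathcal N(X)}\,\|S_{\mathcal Y}f\|_{\mathcal N(Y)}.$$
   Context: All functions are real-valued. $C_b(X)$ is the space of bounded continuous functions with the sup-norm $\|\cdot\|_\infty$. A symmetric kernel $k:X\times X\to\mathbb R$ is strictly positive definite if $(k(x_i,x_j))_{i,j=1}^n$ is positive definite for every finite set of pairwise distinct points. The native space $\mathcal N(X)$ is the reproducing kernel Hilbert space of $k_X$; its canonical features are $\Phi_x=k_X(x,\cdot)$, so $f(x)=\langle f,\Phi_x\rangle_{\mathcal N(X)}$; similarly $\Psi_y=k_Y(y,\cdot)$ for $\mathcal N(Y)$. One has $\mathcal N(X)\subset C_b(X)$ continuously, and likewise for $Y$. The Koopman operator $\mathcal K_A:C_b(Y)\to C_b(X)$ is $\mathcal K_Af=f\circ A$. For a finite set $\mathcal X=\{x_1,\dots,x_N\}\subset X$ of pairwise distinct points, $V_{\mathcal X}=\operatorname{span}\{\Phi_{x_i}:1\le i\le N\}$ (with the native norm), and $S_{\mathcal X}:\mathcal N(X)\to V_{\mathcal X}$ is the orthogonal projection in $\mathcal N(X)$; equivalently $S_{\mathcal X}f$ is the unique element of $V_{\mathcal X}$ agreeing with $f$ on $\mathcal X$. Its extension $\widetilde S_{\mathcal X}:C_b(X)\to V_{\mathcal X}$ maps $f\in C_b(X)$ to the unique element of $V_{\mathcal X}$ agreeing with $f$ on $\mathcal X$. For a finite $\mathcal Y\subset Y$, $V_{\mathcal Y}$ and $S_{\mathcal Y}:\mathcal N(Y)\to V_{\mathcal Y}$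 are defined in the same way using $k_Y$. The approximants are $\widehat{\mathcal K}_A^{\mathcal Y}:=\widetilde S_{\mathcal X}\mathcal K_AS_{\mathcal Y}$ and $\widehat{\mathcal K}_A:=\widehat{\mathcal K}_A^{A(\mathcal X)}=\widetilde S_{\mathcal X}\mathcal K_AS_{A(\mathcal X)}$, as operators on $\mathcal N(Y)$, where $A(\mathcal X)=\{A(x_1),\dots,A(x_N)\}$. $\|T\|_{E\to F}$ denotes the operator norm of $T:E\to F$. *)

theory Defs
  imports "HOL-Analysis.Analysis"
begin

section \<open>Kernels and native spaces\<close>

definition strictly_positive_definite :: "('a \<Rightarrow> 'a \<Rightarrow> real) \<Rightarrow> bool" where
  "strictly_positive_definite k \<longleftrightarrow>
     (\<forall>x y. k x y = k y x) \<and>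
     (\<forall>F c. finite F \<longrightarrow> (\<exists>x\<in>F. c x \<noteq> 0) \<longrightarrow>
        0 < (\<Sum>x\<in>F. \<Sum>y\<in>F. c x * c y * k x y))"

definition ip_norm :: "('v \<Rightarrow> 'v \<Rightarrow> real) \<Rightarrow> 'v \<Rightarrow> real" where
  "ip_norm ip f = sqrt (ip f f)"

text \<open>
  A Hilbert space whose elements are real functions on \<open>'a\<close>, with pointwise operations.
  The values of \<open>ip\<close> outside \<open>H\<close> are irrelevant.
\<close>

locale hilbert_function_space =
  fixes H :: "('a \<Rightarrow> real) set"
    and ip :: "('a \<Rightarrow> real) \<Rightarrow> ('a \<Rightarrow> real) \<Rightarrow> real"
  assumes zero_mem: "(\<lambda>x. 0) \<in> H"
    and add_mem: "\<And>f g. f \<in> H \<Longrightarrow> g \<in> H \<Longrightarrow> (\<lambda>x. f x + g x) \<in> H"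
    and scale_mem: "\<And>c f. f \<in> H \<Longrightarrow> (\<lambda>x. c * f x) \<in> H"
    and ip_commute: "\<And>f g. f \<in> H \<Longrightarrow> g \<in> H \<Longrightarrow> ip f g = ip g f"
    and ip_add_left: "\<And>f g h. f \<in> H \<Longrightarrow> g \<in> H \<Longrightarrow> h \<in> H \<Longrightarrow>
          ip (\<lambda>x. f x + g x) h = ip f h + ip g h"
    and ip_scale_left: "\<And>c f g. f \<in> H \<Longrightarrow> g \<in> H \<Longrightarrow> ip (\<lambda>x. c * f x) g = c * ip f g"
    and ip_pos: "\<And>f. f \<in> H \<Longrightarrow> f \<noteq> (\<lambda>x. 0) \<Longrightarrow> 0 < ip f f"
    and complete: "\<And>u :: nat \<Rightarrow> 'a \<Rightarrow> real. (\<And>n. u n \<in> H) \<Longrightarrow>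
          (\<forall>e>0. \<exists>N. \<forall>m\<ge>N. \<forall>n\<ge>N. ip_norm ip (u m - u n) < e) \<Longrightarrow>
          \<exists>f\<in>H. (\<lambda>n. ip_norm ip (u n - f)) \<longlonglongrightarrow> 0"

text \<open>
  \<open>native_space H ip k\<close>: the space \<open>H\<close> with inner product \<open>ip\<close> is the reproducing kernel
  Hilbert space of \<open>k\<close>.  For a positive definite \<open>k\<close> it exists and is unique (Moore--Aronszajn).
  The canonical feature at \<open>x\<close> is \<open>k x\<close>.
\<close>

locale native_space = hilbert_function_space H ip
  for H :: "('a \<Rightarrow> real) set"
    and ip :: "('a \<Rightarrow> real) \<Rightarrow> ('a \<Rightarrow> real) \<Rightarrow> real" +
  fixes k :: "'a \<Rightarrow> 'a \<Rightarrow> real"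
  assumes feature_mem: "\<And>x. k x \<in> H"
    and reproducing: "\<And>f x. f \<in> H \<Longrightarrow> f x = ip f (k x)"

section \<open>Operators\<close>

definition koopman :: "('a \<Rightarrow> 'b) \<Rightarrow> ('b \<Rightarrow> real) \<Rightarrow> 'a \<Rightarrow> real" where
  "koopman A f = f \<circ> A"

definition feature_span :: "('a \<Rightarrow> 'a \<Rightarrow> real) \<Rightarrow> 'a set \<Rightarrow> ('a \<Rightarrow> real) set" where
  "feature_span k P = {v. \<exists>c. v = (\<lambda>z. \<Sum>x\<in>P. c x * k x z)}"

text \<open>The orthogonal projection \<open>S\<close> onto the span of the features at the finite set \<open>P\<close>.\<close>

definition native_proj ::
  "(('a \<Rightarrow> real) \<Rightarrow> ('a \<Rightarrow> real) \<Rightarrow> real) \<Rightarrow> ('a \<Rightarrow> 'a \<Rightarrow> real) \<Rightarrow> 'a set \<Rightarrow>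
   ('a \<Rightarrow> real) \<Rightarrow> 'a \<Rightarrow> real" where
  "native_proj ip k P f =
     (THE s. s \<in> feature_span k P \<and> (\<forall>v\<in>feature_span k P. ip (f - s) v = 0))"

text \<open>The extension of \<open>S\<close> to bounded continuous functions, by interpolation on \<open>P\<close>.\<close>

definition interpolant :: "('a \<Rightarrow> 'a \<Rightarrow> real) \<Rightarrow> 'a set \<Rightarrow> ('a \<Rightarrow> real) \<Rightarrow> 'a \<Rightarrow> real" where
  "interpolant k P f = (THE s. s \<in> feature_span k P \<and> (\<forall>x\<in>P. s x = f x))"

definition koopman_approx ::
  "('a \<Rightarrow> 'b) \<Rightarrow> ('a \<Rightarrow> 'a \<Rightarrow> real) \<Rightarrow> 'a set \<Rightarrow>
   (('b \<Rightarrow> real) \<Rightarrow> ('b \<Rightarrow> real) \<Rightarrow> real) \<Rightarrow> ('b \<Rightarrow> 'b \<Rightarrow> real) \<Rightarrow> 'b set \<Rightarrow>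
   ('b \<Rightarrow> real) \<Rightarrow> 'a \<Rightarrow> real" where
  "koopman_approx A kX P ipY kY Q f = interpolant kX P (koopman A (native_proj ipY kY Q f))"

section \<open>Norms\<close>

text \<open>
  The library norm of bounded continuous functions, transferred to the underlying functions;
  it is meaningful only for \<open>f \<in> bcontfun\<close>.
\<close>

definition sup_norm :: "('a::topological_space \<Rightarrow> real) \<Rightarrow> real" where
  "sup_norm f = norm (Bcontfun f)"

text \<open>
  The norm of \<open>T\<close> as an operator from the subspace \<open>E\<close> with norm \<open>nE\<close> into a space with
  norm \<open>nF\<close>.  The supremum is taken in the reals, so the value is meaningful only for
  bounded operators.
\<close>

definition op_norm ::
  "'v set \<Rightarrow> ('v \<Rightarrow> real) \<Rightarrow> ('w \<Rightarrow> real) \<Rightarrow> ('v \<Rightarrow> 'w) \<Rightarrow> real" where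
  "op_norm E nE nF T = (SUP f\<in>{f \<in> E. nE f \<le> 1}. nF (T f))"

end

theory Submission
  imports Defs "HOL-Library.Function_Algebras"
begin

text \<open>
  Write \<open>S\<close> for the projection at the centers \<open>P\<close> of \<open>X\<close>, and \<open>K\<close> for composition with \<open>A\<close>.  In
  the native space the value at \<open>x\<close> is the inner product with the feature at \<open>x\<close>, so a residual is
  orthogonal to the features at \<open>P\<close> exactly when it vanishes on \<open>P\<close>: projection and interpolation
  agree on \<open>NX\<close> (\<open>native_proj_eq_interpolant\<close>).  As \<open>K\<close> maps \<open>NY\<close> into \<open>NX\<close>, this turns both errors
  into algebra.  Projecting \<open>f\<close> at \<open>A ` P\<close> keeps the values of \<open>f \<circ> A\<close> on \<open>P\<close>, so the first error is
  \<open>(I - S) (K f)\<close>.  With \<open>g\<close> the projection of \<open>f\<close> at \<open>Q\<close>, the second error is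
  \<open>K (f - g) + (I - S) (K g)\<close>, and \<open>K\<close> does not increase the supremum norm.

  What remains is that every operator norm on the right is the norm of a bounded operator; only
  then is the norm of an image at most the operator norm times the norm of the argument.  For
  \<open>I - S\<close> this follows from boundedness of the kernel (\<open>sup_norm_residual_le\<close>).  For \<open>K\<close> the
  hypothesis gives only an inclusion of spaces, and boundedness is an instance of the closed graph
  theorem (\<open>koopman_bounded\<close>), which is derived here from the uniform boundedness principle
  (\<open>weakly_bounded_imp_bounded\<close>) and the density of the features (\<open>norm_le_if_proj_norm_le\<close>).
\<close>

section \<open>Geometry of Hilbert function spaces\<close>

context hilbert_function_space
begin

lemma add_in: "f \<in> H \<Longrightarrow> g \<in> H \<Longrightarrow> f + g \<in> H"
  using add_mem[of f g] by (simp add: plus_fun_def)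

lemma uminus_in: "f \<in> H \<Longrightarrow> - f \<in> H"
  using scale_mem[of f "-1"] by (simp add: fun_Compl_def)

lemma diff_in: "f \<in> H \<Longrightarrow> g \<in> H \<Longrightarrow> f - g \<in> H"
  using add_in[OF _ uminus_in, of f g] by simp

lemma zero_in: "0 \<in> H"
  using zero_mem by (simp add: zero_fun_def)

lemma lincomb_in:
  assumes "\<And>i. i \<in> I \<Longrightarrow> f i \<in> H"
  shows "(\<lambda>z. \<Sum>i\<in>I. c i * f i z) \<in> H"
  using assms
proof (induction I rule: infinite_finite_induct)
  case (insert i I)
  then have "(\<lambda>z. c i * f i z + (\<Sum>i\<in>I. c i * f i z)) \<in> H"
    by (intro add_mem scale_mem) auto
  with insert show ?case by simp
qed (auto simp: zero_mem)

lemma ip_add: "f \<in> H \<Longrightarrow> g \<in> H \<Longrightarrow> h \<in> H \<Longrightarrow> ip (f + g) h = ip f h + ip g h"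
  using ip_add_left[of f g h] by (simp add: plus_fun_def)

lemma ip_uminus: "f \<in> H \<Longrightarrow> h \<in> H \<Longrightarrow> ip (- f) h = - ip f h"
  using ip_scale_left[of f h "-1"] by (simp add: fun_Compl_def)

lemma ip_diff: "f \<in> H \<Longrightarrow> g \<in> H \<Longrightarrow> h \<in> H \<Longrightarrow> ip (f - g) h = ip f h - ip g h"
  using ip_add[of f "- g" h] ip_uminus[of g h] uminus_in[of g] by simp

lemma ip_add_right: "f \<in> H \<Longrightarrow> g \<in> H \<Longrightarrow> h \<in> H \<Longrightarrow> ip h (f + g) = ip h f + ip h g"
  by (metis add_in ip_add ip_commute)

lemma ip_diff_right: "f \<in> H \<Longrightarrow> g \<in> H \<Longrightarrow> h \<in> H \<Longrightarrow> ip h (f - g) = ip h f - ip h g"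
  by (metis diff_in ip_diff ip_commute)

lemma ip_scale_right: "f \<in> H \<Longrightarrow> g \<in> H \<Longrightarrow> ip f (\<lambda>x. c * g x) = c * ip f g"
  by (metis ip_scale_left ip_commute scale_mem)

lemma ip_zero_left: "f \<in> H \<Longrightarrow> ip 0 f = 0"
  using ip_diff[of 0 0 f] zero_in by simp

lemma ip_zero_right: "f \<in> H \<Longrightarrow> ip f 0 = 0"
  using ip_zero_left ip_commute zero_in by metis

lemma ip_lincomb_right:
  assumes "\<And>i. i \<in> I \<Longrightarrow> f i \<in> H" and "g \<in> H"
  shows "ip g (\<lambda>z. \<Sum>i\<in>I. c i * f i z) = (\<Sum>i\<in>I. c i * ip g (f i))"
  using assms(1)
proof (induction I rule: infinite_finite_induct)
  case (insert i I)
  have 1: "(\<lambda>z. c i * f i z) \<in> H" "(\<lambda>z. \<Sum>i\<in>I. c i * f i z) \<in> H"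
    using insert by (auto intro!: scale_mem lincomb_in)
  have "ip g ((\<lambda>z. c i * f i z) + (\<lambda>z. \<Sum>i\<in>I. c i * f i z))
      = c i * ip g (f i) + (\<Sum>i\<in>I. c i * ip g (f i))"
    using insert 1 assms(2) by (simp add: ip_add_right ip_scale_right)
  with insert show ?case by (simp add: plus_fun_def)
qed (use ip_zero_right[OF assms(2)] in \<open>simp_all add: zero_fun_def\<close>)

lemma ip_self_nonneg: "f \<in> H \<Longrightarrow> 0 \<le> ip f f"
  using ip_pos[of f] ip_zero_left[OF zero_in] by (cases "f = 0") (auto simp: zero_fun_def)

lemma ip_self_eq_0_iff: "f \<in> H \<Longrightarrow> ip f f = 0 \<longleftrightarrow> f = 0"
  using ip_pos[of f] ip_zero_left[OF zero_in] by (cases "f = 0") (auto simp: zero_fun_def)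

lemma norm_nonneg: "f \<in> H \<Longrightarrow> 0 \<le> ip_norm ip f"
  by (simp add: ip_norm_def ip_self_nonneg)

lemma norm_sq: "f \<in> H \<Longrightarrow> (ip_norm ip f)\<^sup>2 = ip f f"
  by (simp add: ip_norm_def ip_self_nonneg)

lemma norm_zero: "ip_norm ip 0 = 0"
  by (simp add: ip_norm_def ip_zero_left zero_in)

lemma norm_eq_0_iff: "f \<in> H \<Longrightarrow> ip_norm ip f = 0 \<longleftrightarrow> f = 0"
  by (simp add: ip_norm_def ip_self_eq_0_iff)

lemma norm_scale: "f \<in> H \<Longrightarrow> ip_norm ip (\<lambda>x. c * f x) = \<bar>c\<bar> * ip_norm ip f"
  by (simp add: ip_norm_def ip_scale_left ip_scale_right scale_mem real_sqrt_mult
      flip: mult.assoc)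

lemma norm_minus_commute: "f \<in> H \<Longrightarrow> g \<in> H \<Longrightarrow> ip_norm ip (f - g) = ip_norm ip (g - f)"
  by (simp add: ip_norm_def ip_diff ip_diff_right diff_in ip_commute)

lemma Cauchy_Schwarz:
  assumes "f \<in> H" "g \<in> H"
  shows "\<bar>ip f g\<bar> \<le> ip_norm ip f * ip_norm ip g"
proof (cases "g = 0")
  case True
  then show ?thesis using assms ip_zero_left[of f] ip_commute[of f g]
    by (simp add: norm_zero)
next
  case False
  then have pos: "0 < ip g g"
    using assms ip_pos[of g] by (simp add: zero_fun_def)
  define a where "a = ip f g / ip g g"
  define h where "h = (\<lambda>x. a * g x)"
  have h: "h \<in> H" "ip h f = a * ip f g" "ip f h = a * ip f g" "ip h h = a * a * ip g g"
    using assms by (auto simp: h_def scale_mem ip_scale_left ip_scale_right ip_commute)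
  have "0 \<le> ip (f - h) (f - h)"
    using assms h by (intro ip_self_nonneg diff_in)
  also have "\<dots> = ip f f - 2 * (a * ip f g) + a * a * ip g g"
    using assms h by (simp add: ip_diff ip_diff_right diff_in)
  also have "\<dots> = ip f f - (ip f g)\<^sup>2 / ip g g"
    using pos by (simp add: a_def power2_eq_square field_simps)
  finally have "(ip f g)\<^sup>2 \<le> ip f f * ip g g"
    using pos by (simp add: field_simps)
  then have "sqrt ((ip f g)\<^sup>2) \<le> sqrt (ip f f * ip g g)"
    by (rule real_sqrt_le_mono)
  then show ?thesis by (simp add: ip_norm_def real_sqrt_mult)
qed

lemma norm_triangle:
  assumes "f \<in> H" "g \<in> H"
  shows "ip_norm ip (f + g) \<le> ip_norm ip f + ip_norm ip g"
proof (rule power2_le_imp_le)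
  have "(ip_norm ip (f + g))\<^sup>2 = ip f f + 2 * ip f g + ip g g"
    using assms by (simp add: norm_sq add_in ip_add ip_add_right ip_commute[of g f])
  also have "\<dots> \<le> (ip_norm ip f)\<^sup>2 + 2 * (ip_norm ip f * ip_norm ip g) + (ip_norm ip g)\<^sup>2"
    using Cauchy_Schwarz[OF assms] assms by (simp add: norm_sq)
  also have "\<dots> = (ip_norm ip f + ip_norm ip g)\<^sup>2"
    by (simp add: power2_sum)
  finally show "(ip_norm ip (f + g))\<^sup>2 \<le> (ip_norm ip f + ip_norm ip g)\<^sup>2" .
qed (use assms norm_nonneg in auto)

lemma norm_diff_triangle:
  assumes "f \<in> H" "g \<in> H" "h \<in> H"
  shows "ip_norm ip (f - h) \<le> ip_norm ip (f - g) + ip_norm ip (g - h)"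
  using norm_triangle[OF diff_in diff_in, of f g g h] assms by simp

text \<open>
  The uniform boundedness principle, by a gliding hump instead of a category argument.  If the
  norms of \<open>w n \<in> W\<close> grow like \<open>6 ^ n\<close>, a point is built by steps of length \<open>(1/3) ^ n\<close>: moving
  along \<open>w n\<close> or against it, one of the two choices makes the pairing with \<open>w n\<close> at least
  \<open>(1/3) ^ n\<close> times the norm of \<open>w n\<close>.  All later steps together have half that length, so the
  limit keeps half of this pairing, and its pairings with \<open>W\<close> are unbounded.
\<close>

lemma weakly_bounded_imp_bounded:
  assumes "W \<subseteq> H" and weak: "\<And>f. f \<in> H \<Longrightarrow> \<exists>C. \<forall>w\<in>W. \<bar>ip f w\<bar> \<le> C"
  shows "\<exists>C. \<forall>w\<in>W. ip_norm ip w \<le> C"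
proof (rule ccontr)
  assume "\<not> ?thesis"
  then have "\<forall>n. \<exists>w. w \<in> W \<and> 6 ^ n < ip_norm ip w"
    by (meson not_le)
  then obtain w where wW: "\<And>n. w n \<in> W" and w_large: "\<And>n::nat. 6 ^ n < ip_norm ip (w n)"
    by metis
  have w: "w n \<in> H" for n using wW assms(1) by blast
  have w_pos: "0 < ip_norm ip (w n)" for n
    using w_large[of n] by (smt (verit) zero_le_power)
  have "\<exists>f. \<forall>n. f n \<in> H \<and> (ip_norm ip (f (Suc n) - f n) \<le> (1/3) ^ n \<and>
          (1/3) ^ n * ip_norm ip (w n) \<le> \<bar>ip (f (Suc n)) (w n)\<bar>)"
  proof (rule dependent_nat_choice)
    fix g and n :: nat
    assume g: "g \<in> H"
    define a where "a = (1/3) ^ n / ip_norm ip (w n)"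
    have a: "0 \<le> a" "a * ip_norm ip (w n) = (1/3) ^ n"
      using w_pos[of n] by (auto simp: a_def)
    define e where "e = (\<lambda>x. a * w n x)"
    have "e \<in> H" using w by (simp add: e_def scale_mem)
    moreover have "ip e (w n) = (1/3) ^ n * ip_norm ip (w n)"
      using w by (simp add: e_def ip_scale_left power2_eq_square flip: a(2) norm_sq[OF w[of n]])
    moreover have "ip_norm ip e = (1/3) ^ n"
      using w a by (simp add: e_def norm_scale)
    ultimately have e: "e \<in> H" "ip e (w n) = (1/3) ^ n * ip_norm ip (w n)"
      "ip_norm ip e = (1/3) ^ n" .
    have "ip (g + e) (w n) = ip g (w n) + ip e (w n)"
      "ip (g - e) (w n) = ip g (w n) - ip e (w n)"
      using e g w by (auto simp: ip_add ip_diff)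
    then have "ip e (w n) \<le> \<bar>ip (g + e) (w n)\<bar> \<or> ip e (w n) \<le> \<bar>ip (g - e) (w n)\<bar>"
      by linarith
    moreover have "ip_norm ip (g + e - g) = (1/3) ^ n" "ip_norm ip (g - e - g) = (1/3) ^ n"
      using norm_minus_commute[of e 0] e zero_in by simp_all
    ultimately show "\<exists>f. f \<in> H \<and> (ip_norm ip (f - g) \<le> (1/3) ^ n \<and>
          (1/3) ^ n * ip_norm ip (w n) \<le> \<bar>ip f (w n)\<bar>)"
      using e(2) add_in[OF g e(1)] diff_in[OF g e(1)] by (metis order_refl)
  qed (rule exI, rule zero_in)
  then obtain f where f: "\<And>n. f n \<in> H"
    and step: "\<And>n::nat. ip_norm ip (f (Suc n) - f n) \<le> (1/3) ^ n"
    and hump: "\<And>n. (1/3) ^ n * ip_norm ip (w n) \<le> \<bar>ip (f (Suc n)) (w n)\<bar>"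
    by metis
  have tail: "ip_norm ip (f (Suc n + p) - f (Suc n)) \<le> (1/2) * (1/3) ^ n * (1 - (1/3) ^ p)"
    for n p :: nat
  proof (induction p)
    case 0
    then show ?case by (simp add: norm_zero[unfolded zero_fun_def])
  next
    case (Suc p)
    have "ip_norm ip (f (Suc n + Suc p) - f (Suc n))
        \<le> ip_norm ip (f (Suc (Suc n + p)) - f (Suc n + p)) + ip_norm ip (f (Suc n + p) - f (Suc n))"
      using norm_diff_triangle[of "f (Suc n + Suc p)" "f (Suc n + p)" "f (Suc n)"] f by simp
    also have "\<dots> \<le> (1/3) ^ (Suc n + p) + (1/2) * (1/3) ^ n * (1 - (1/3) ^ p)"
      by (intro add_mono step Suc.IH)
    also have "\<dots> = (1/2) * (1/3) ^ n * (1 - (1/3) ^ Suc p)"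
      by (simp add: power_add field_simps)
    finally show ?case .
  qed
  have tail': "ip_norm ip (f m - f (Suc n)) \<le> (1/2) * (1/3) ^ n" if m: "Suc n \<le> m" for m n
  proof -
    obtain p where p: "m = Suc n + p" using m by (metis le_add_diff_inverse)
    have "(1/2) * (1/3) ^ n * (1 - (1/3) ^ p) \<le> (1/2) * (1/3::real) ^ n"
      by (intro mult_left_le) auto
    then show ?thesis unfolding p by (rule order.trans[OF tail])
  qed
  have "\<exists>N. \<forall>m\<ge>N. \<forall>n\<ge>N. ip_norm ip (f m - f n) < e" if e: "e > 0" for e
  proof -
    obtain n where n: "(1/3) ^ n < e"
      using real_arch_pow_inv[OF e, of "1/3"] by auto
    have "ip_norm ip (f m - f m') < e" if "Suc n \<le> m" "Suc n \<le> m'" for m m'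
      using norm_diff_triangle[of "f m" "f (Suc n)" "f m'"] tail'[OF that(1)] tail'[OF that(2)]
        norm_minus_commute[of "f m'" "f (Suc n)"] f n by simp
    then show ?thesis by blast
  qed
  then obtain g where g: "g \<in> H" and lim: "(\<lambda>n. ip_norm ip (f n - g)) \<longlonglongrightarrow> 0"
    using complete[of f] f by blast
  have close: "ip_norm ip (g - f (Suc n)) \<le> (1/2) * (1/3) ^ n" for n
  proof (rule LIMSEQ_le_const)
    show "(\<lambda>m. ip_norm ip (f m - g) + (1/2) * (1/3) ^ n) \<longlonglongrightarrow> (1/2) * (1/3) ^ n"
      using tendsto_add[OF lim tendsto_const[of "(1/2) * (1/3::real) ^ n"]] by simp
    have "ip_norm ip (g - f (Suc n)) \<le> ip_norm ip (f m - g) + (1/2) * (1/3) ^ n"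
      if "Suc n \<le> m" for m
      using norm_diff_triangle[of g "f m" "f (Suc n)"] norm_minus_commute[of g "f m"]
        tail'[OF that] f g by simp
    then show "\<exists>N. \<forall>m\<ge>N. ip_norm ip (g - f (Suc n)) \<le> ip_norm ip (f m - g) + (1/2) * (1/3) ^ n"
      by blast
  qed
  obtain C where C: "\<And>v. v \<in> W \<Longrightarrow> \<bar>ip g v\<bar> \<le> C"
    using weak[OF g] by blast
  have "2 ^ n \<le> 2 * C" for n :: nat
  proof -
    have "ip g (w n) = ip (f (Suc n)) (w n) + ip (g - f (Suc n)) (w n)"
      using f g w by (simp add: ip_diff)
    moreover have "\<bar>ip (g - f (Suc n)) (w n)\<bar> \<le> (1/2) * (1/3) ^ n * ip_norm ip (w n)"
      using Cauchy_Schwarz[OF diff_in w, of g "f (Suc n)" n] f g w_pos[of n] close[of n]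
      by (meson less_imp_le mult_right_mono order.trans)
    ultimately have "(1/2) * ((1/3) ^ n * ip_norm ip (w n)) \<le> C"
      using hump[of n] C[OF wW, of n] by linarith
    moreover have "(1/3) ^ n * 6 ^ n \<le> (1/3) ^ n * ip_norm ip (w n)"
      using w_large[of n] by (intro mult_left_mono) auto
    moreover have "(1/3) ^ n * 6 ^ n = (2::real) ^ n"
      by (simp flip: power_mult_distrib)
    ultimately show ?thesis by linarith
  qed
  moreover obtain n where "2 * C < 2 ^ n" using real_arch_pow[of 2 "2 * C"] by auto
  ultimately show False using not_less by blast
qed

end
section \<open>Projection and interpolation in native spaces\<close>

lemma feature_span_scale:
  assumes "v \<in> feature_span k F" shows "(\<lambda>z. a * v z) \<in> feature_span k F"
proof -
  obtain c where "v = (\<lambda>z. \<Sum>x\<in>F. c x * k x z)" using assms by (auto simp: feature_span_def)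
  then have "(\<lambda>z. a * v z) = (\<lambda>z. \<Sum>x\<in>F. (a * c x) * k x z)"
    by (simp add: sum_distrib_left mult.assoc)
  then show ?thesis by (auto simp: feature_span_def)
qed

lemma feature_span_add:
  assumes "v \<in> feature_span k F" "w \<in> feature_span k F" shows "v + w \<in> feature_span k F"
proof -
  obtain c d where "v = (\<lambda>z. \<Sum>x\<in>F. c x * k x z)" "w = (\<lambda>z. \<Sum>x\<in>F. d x * k x z)"
    using assms by (auto simp: feature_span_def)
  then have "v + w = (\<lambda>z. \<Sum>x\<in>F. (c x + d x) * k x z)"
    by (simp add: plus_fun_def sum.distrib distrib_right)
  then show ?thesis by (auto simp: feature_span_def)
qed

lemma feature_span_diff:
  assumes "v \<in> feature_span k F" "w \<in> feature_span k F" shows "v - w \<in> feature_span k F"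
  using feature_span_add[OF assms(1) feature_span_scale[OF assms(2), of "-1"]]
  by (simp add: plus_fun_def fun_diff_def)

lemma feature_span_mono:
  assumes "v \<in> feature_span k F" "F \<subseteq> G" "finite G" shows "v \<in> feature_span k G"
proof -
  obtain c where c: "v = (\<lambda>z. \<Sum>x\<in>F. c x * k x z)" using assms by (auto simp: feature_span_def)
  have "v = (\<lambda>z. \<Sum>x\<in>G. (if x \<in> F then c x else 0) * k x z)"
    unfolding c using assms(2,3)
    by (auto intro!: sum.mono_neutral_cong_left)
  then show ?thesis by (auto simp: feature_span_def intro: exI[of _ "\<lambda>x. if x \<in> F then c x else 0"])
qed

lemma feature_in_span: "finite F \<Longrightarrow> x \<in> F \<Longrightarrow> k x \<in> feature_span k F"
  by (auto simp: feature_span_def if_distrib[of "\<lambda>t. t * _"] cong: if_cong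
      intro!: exI[of _ "\<lambda>y. if y = x then 1 else 0"])

context native_space
begin

lemma span_in: "v \<in> feature_span k F \<Longrightarrow> v \<in> H"
  by (auto simp: feature_span_def intro: lincomb_in feature_mem)

text \<open>
  By the reproducing property, the inner product with the feature at \<open>x\<close> is the value at \<open>x\<close>.
\<close>

lemma vanish_imp_orthogonal:
  assumes "g \<in> H" "\<And>x. x \<in> F \<Longrightarrow> g x = 0" "v \<in> feature_span k F"
  shows "ip g v = 0"
proof -
  obtain c where "v = (\<lambda>z. \<Sum>x\<in>F. c x * k x z)" using assms(3) by (auto simp: feature_span_def)
  then have "ip g v = (\<Sum>x\<in>F. c x * ip g (k x))"
    using assms(1) by (simp add: ip_lincomb_right feature_mem)
  also have "\<dots> = 0"
    using assms(1,2) reproducing[of g] by simp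
  finally show ?thesis .
qed

text \<open>
  Induction on the centers is Gram--Schmidt: \<open>r\<close> is the part of the new feature orthogonal to the
  old ones, and \<open>r x\<close> is its squared norm.  If it is zero, the new feature already lies in the old
  span, and the old interpolant automatically has the right value at \<open>x\<close>.
\<close>

lemma interpolant_exists:
  assumes "finite F" "f \<in> H"
  shows "\<exists>s\<in>feature_span k F. \<forall>x\<in>F. s x = f x"
  using assms
proof (induction F arbitrary: f)
  case empty
  then show ?case by (auto simp: feature_span_def)
next
  case (insert x F)
  obtain s where s: "s \<in> feature_span k F" "\<And>y. y \<in> F \<Longrightarrow> s y = f y"
    using insert by blast
  obtain t where t: "t \<in> feature_span k F" "\<And>y. y \<in> F \<Longrightarrow> t y = k x y"
    using insert.IH[OF feature_mem[of x]] by blast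
  define r where "r = k x - t"
  have r: "r \<in> H" "\<And>y. y \<in> F \<Longrightarrow> r y = 0"
    using t by (auto simp: r_def diff_in feature_mem span_in)
  have kx: "k x = r + t" by (simp add: r_def)
  have rx: "r x = ip r r"
  proof -
    have "r x = ip r (r + t)" using reproducing[OF r(1), of x] kx by simp
    also have "\<dots> = ip r r"
      using r t(1) vanish_imp_orthogonal[OF r t(1)] by (simp add: ip_add_right span_in)
    finally show ?thesis .
  qed
  have mono: "v \<in> feature_span k (insert x F)" if "v \<in> feature_span k F" for v
    using feature_span_mono[OF that, of "insert x F"] insert.hyps by blast
  show ?case
  proof (cases "r = 0")
    case True
    have "(f - s) x = ip (f - s) (k x)"
      by (rule reproducing[OF diff_in[OF insert.prems span_in[OF s(1)]]])
    also have "\<dots> = 0"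
      using True kx t s insert.prems
      by (intro vanish_imp_orthogonal[of _ F]) (auto simp: diff_in span_in)
    finally show ?thesis using s mono by (intro bexI[of _ s]) auto
  next
    case False
    then have "r x \<noteq> 0" using rx r by (simp add: ip_self_eq_0_iff)
    moreover have "r \<in> feature_span k (insert x F)"
      unfolding r_def using t insert.hyps by (intro feature_span_diff mono feature_in_span) auto
    ultimately show ?thesis
      using s r mono
      by (intro bexI[of _ "s + (\<lambda>z. ((f x - s x) / r x) * r z)"] feature_span_add
          feature_span_scale) auto
  qed
qed

lemma interpolant_unique:
  assumes "s \<in> feature_span k F" "t \<in> feature_span k F" "\<And>x. x \<in> F \<Longrightarrow> s x = t x"
  shows "s = t"
proof -
  have "ip (s - t) (s - t) = 0"
    using assms by (intro vanish_imp_orthogonal[of _ F]) (auto intro: span_in feature_span_diff)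
  then have "s - t = 0"
    using assms by (simp add: ip_self_eq_0_iff diff_in span_in)
  then show ?thesis by simp
qed

lemma interpolant_eqI:
  assumes "s \<in> feature_span k F" "\<And>x. x \<in> F \<Longrightarrow> s x = f x"
  shows "interpolant k F f = s"
  unfolding interpolant_def
  by (rule the_equality) (use assms in \<open>auto intro!: interpolant_unique[of _ F s]\<close>)

lemma interpolant_spec:
  assumes "finite F" "f \<in> H"
  shows "interpolant k F f \<in> feature_span k F" "\<And>x. x \<in> F \<Longrightarrow> interpolant k F f x = f x"
  using interpolant_exists[OF assms] interpolant_eqI[of _ F f] by auto

text \<open>
  The two descriptions select the same element of the span because \<open>f - s\<close> is orthogonal to the
  features at \<open>F\<close> if and only if \<open>s\<close> takes the values of \<open>f\<close> on \<open>F\<close>.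
\<close>

lemma native_proj_eq_interpolant:
  assumes "finite F" "f \<in> H"
  shows "native_proj ip k F f = interpolant k F f"
proof -
  have eq: "(\<forall>v\<in>feature_span k F. ip (f - s) v = 0) \<longleftrightarrow> (\<forall>x\<in>F. s x = f x)"
    if "s \<in> feature_span k F" for s
  proof safe
    fix x assume *: "\<forall>v\<in>feature_span k F. ip (f - s) v = 0" "x \<in> F"
    have "(f - s) x = ip (f - s) (k x)"
      by (rule reproducing[OF diff_in[OF assms(2) span_in[OF that]]])
    also have "\<dots> = 0"
      using * feature_in_span[OF assms(1) *(2)] by blast
    finally show "s x = f x" by simp
  next
    fix v assume "\<forall>x\<in>F. s x = f x" "v \<in> feature_span k F"
    then show "ip (f - s) v = 0"
      using assms that by (intro vanish_imp_orthogonal[of _ F]) (auto simp: diff_in span_in)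
  qed
  have "(\<lambda>s. s \<in> feature_span k F \<and> (\<forall>v\<in>feature_span k F. ip (f - s) v = 0))
      = (\<lambda>s. s \<in> feature_span k F \<and> (\<forall>x\<in>F. s x = f x))"
    by (intro ext conj_cong refl eq)
  then show ?thesis
    unfolding native_proj_def interpolant_def by (rule arg_cong)
qed

lemma
  assumes "finite F" "f \<in> H"
  shows native_proj_in_span: "native_proj ip k F f \<in> feature_span k F"
    and native_proj_in: "native_proj ip k F f \<in> H"
    and native_proj_eq_on: "\<And>x. x \<in> F \<Longrightarrow> native_proj ip k F f x = f x"
  using interpolant_spec[OF assms] by (auto simp: native_proj_eq_interpolant[OF assms] span_in)

lemma native_proj_scale:
  assumes "finite F" "f \<in> H"
  shows "native_proj ip k F (\<lambda>x. c * f x) = (\<lambda>x. c * native_proj ip k F f x)"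
  using assms
  by (subst native_proj_eq_interpolant)
    (auto intro!: interpolant_eqI feature_span_scale native_proj_in_span scale_mem
      simp: native_proj_eq_on)

lemma Pythagoras:
  assumes "finite F" "f \<in> H" "s \<in> feature_span k F" "\<And>x. x \<in> F \<Longrightarrow> s x = f x"
  shows "ip f f = ip s s + ip (f - s) (f - s)"
proof -
  have "s \<in> H" "f - s \<in> H" using assms by (auto simp: span_in diff_in)
  moreover have "ip (f - s) s = 0"
    using assms calculation by (intro vanish_imp_orthogonal[of _ F]) auto
  ultimately show ?thesis
    using assms(2) by (simp add: ip_diff ip_diff_right ip_commute[of s f])
qed

lemma
  assumes "finite F" "f \<in> H"
  shows norm_proj_le: "ip_norm ip (native_proj ip k F f) \<le> ip_norm ip f"
    and norm_proj_residual_le: "ip_norm ip (f - native_proj ip k F f) \<le> ip_norm ip f"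
  using Pythagoras[OF assms native_proj_in_span[OF assms] native_proj_eq_on[OF assms]]
    ip_self_nonneg[OF native_proj_in[OF assms]]
    ip_self_nonneg[OF diff_in[OF assms(2) native_proj_in[OF assms]]]
  by (simp_all add: ip_norm_def)

lemma ip_features: "ip (k x) (k y) = k x y"
  by (rule reproducing[OF feature_mem, symmetric])

lemma norm_kernel: "ip_norm ip (k x) = sqrt (k x x)"
  by (simp add: ip_norm_def ip_features)

lemma eval_le: "f \<in> H \<Longrightarrow> \<bar>f x\<bar> \<le> ip_norm ip f * sqrt (k x x)"
  using Cauchy_Schwarz[OF _ feature_mem, of f x] by (simp add: reproducing[of f] norm_kernel)

lemma norm_limit_imp_pointwise:
  assumes "\<And>n. u n \<in> H" "f \<in> H" "(\<lambda>n. ip_norm ip (u n - f)) \<longlonglongrightarrow> 0"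
  shows "(\<lambda>n. u n x) \<longlonglongrightarrow> f x"
proof -
  have lim: "(\<lambda>n. ip_norm ip (u n - f) * sqrt (k x x)) \<longlonglongrightarrow> 0"
    using tendsto_mult_right[OF assms(3), of "sqrt (k x x)"] by simp
  have le: "norm (u n x - f x) \<le> ip_norm ip (u n - f) * sqrt (k x x)" for n
    using eval_le[OF diff_in[OF assms(1,2)], of n x] by simp
  have "(\<lambda>n. u n x - f x) \<longlonglongrightarrow> 0"
    by (rule Lim_null_comparison[OF _ lim]) (intro always_eventually allI le)
  then show ?thesis by (simp add: LIM_zero_iff)
qed

text \<open>
  The projections onto spans of features recover the norm: this is density of the features.  Take
  finite sets \<open>F n\<close> along which the squared norms of the projections \<open>s n\<close> approach their supremum.
  By Pythagoras, enlarging \<open>F n\<close> moves the projection by less than \<open>sqrt (1 / (n + 1))\<close>.  Passing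
  to \<open>F m \<union> F n\<close> shows that \<open>s\<close> is Cauchy, and passing to \<open>insert x (F n)\<close> shows that
  \<open>s\<close> converges to \<open>f\<close> at every \<open>x\<close>.
\<close>

lemma norm_le_if_proj_norm_le:
  assumes f: "f \<in> H" and bound: "\<And>F. finite F \<Longrightarrow> ip_norm ip (native_proj ip k F f) \<le> C"
  shows "ip_norm ip f \<le> C"
proof -
  define S where "S F = native_proj ip k F f" for F
  have S: "S F \<in> feature_span k F" "S F \<in> H" "\<And>x. x \<in> F \<Longrightarrow> S F x = f x" if "finite F" for F
    using that f by (auto simp: S_def native_proj_in_span native_proj_in native_proj_eq_on)
  define q where "q F = ip (S F) (S F)" for F
  have q_le: "q F \<le> ip f f" if "finite F" for F
    using Pythagoras[OF that f S(1)[OF that] S(3)[OF that]]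
      ip_self_nonneg[OF diff_in[OF f S(2)[OF that]]]
    by (simp add: q_def)
  have bdd: "bdd_above (q ` Collect finite)"
    using q_le by (auto simp: bdd_above_def)
  define \<sigma> where "\<sigma> = (SUP F\<in>Collect finite. q F)"
  have q_sup: "q F \<le> \<sigma>" if "finite F" for F
    unfolding \<sigma>_def using that bdd by (intro cSUP_upper) auto
  have "\<exists>F. finite F \<and> \<sigma> - 1 / real (Suc n) < q F" for n
    using less_cSUP_iff[OF _ bdd, of "\<sigma> - 1 / real (Suc n)"] finite.emptyI
    by (auto simp flip: \<sigma>_def)
  then obtain F where F: "\<And>n. finite (F n)" and F_sup: "\<And>n. \<sigma> - 1 / real (Suc n) < q (F n)"
    by metis
  define s where "s n = S (F n)" for n
  have s: "s n \<in> H" for n by (simp add: s_def S F)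
  define \<delta> where "\<delta> n = sqrt (1 / real (Suc n))" for n
  have \<delta>_lim: "\<delta> \<longlonglongrightarrow> 0"
    unfolding \<delta>_def using tendsto_real_sqrt[OF LIMSEQ_inverse_real_of_nat]
    by (simp add: inverse_eq_divide)
  have grow: "ip_norm ip (S G - s n) \<le> \<delta> n" if "F n \<subseteq> G" "finite G" for G n
  proof -
    have "q G = q (F n) + ip (S G - s n) (S G - s n)"
      unfolding q_def s_def using that F[of n] S[OF that(2)] S[OF F[of n]]
      by (intro Pythagoras) auto
    then have "ip (S G - s n) (S G - s n) \<le> 1 / real (Suc n)"
      using q_sup[OF that(2)] F_sup[of n] by linarith
    then show ?thesis
      unfolding ip_norm_def \<delta>_def by (rule real_sqrt_le_mono)
  qed
  have "\<exists>N. \<forall>m\<ge>N. \<forall>n\<ge>N. ip_norm ip (s m - s n) < e" if "e > 0" for e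
  proof -
    have "\<forall>\<^sub>F n in sequentially. \<delta> n < e / 2"
      using order_tendstoD(2)[OF \<delta>_lim, of "e / 2"] that by simp
    then obtain N where N: "\<And>n. n \<ge> N \<Longrightarrow> \<delta> n < e / 2"
      by (auto simp: eventually_sequentially)
    have "ip_norm ip (s m - s n) < e" if "m \<ge> N" "n \<ge> N" for m n
    proof -
      let ?G = "F m \<union> F n"
      have G: "S ?G \<in> H" using S(2)[of ?G] F by blast
      have "ip_norm ip (s m - s n) \<le> ip_norm ip (S ?G - s m) + ip_norm ip (S ?G - s n)"
        using norm_diff_triangle[OF s G s, of m n] norm_minus_commute[OF s G, of m] by simp
      also have "\<dots> \<le> \<delta> m + \<delta> n" using F by (intro add_mono grow) auto
      finally show ?thesis using N[OF that(1)] N[OF that(2)] by simp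
    qed
    then show ?thesis by blast
  qed
  then obtain g where g: "g \<in> H" and lim: "(\<lambda>n. ip_norm ip (s n - g)) \<longlonglongrightarrow> 0"
    using complete[of s] s by blast
  have "g x = f x" for x
  proof -
    have le: "norm (s n x - f x) \<le> \<delta> n * sqrt (k x x)" for n
    proof -
      let ?G = "insert x (F n)"
      have G: "S ?G \<in> H" "S ?G x = f x" using S(2)[of ?G] S(3)[of ?G x] F by auto
      have k: "0 \<le> sqrt (k x x)" using norm_nonneg[OF feature_mem[of x]] by (simp add: norm_kernel)
      have "norm (s n x - f x) = \<bar>(S ?G - s n) x\<bar>" using G by simp
      also have "\<dots> \<le> ip_norm ip (S ?G - s n) * sqrt (k x x)"
        using G s by (intro eval_le diff_in)
      also have "\<dots> \<le> \<delta> n * sqrt (k x x)"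
        using F k by (intro mult_right_mono grow) auto
      finally show ?thesis .
    qed
    have lim': "(\<lambda>n. \<delta> n * sqrt (k x x)) \<longlonglongrightarrow> 0"
      using tendsto_mult_right[OF \<delta>_lim, of "sqrt (k x x)"] by simp
    have "(\<lambda>n. s n x - f x) \<longlonglongrightarrow> 0"
      by (rule Lim_null_comparison[OF _ lim']) (intro always_eventually allI le)
    then have "(\<lambda>n. s n x) \<longlonglongrightarrow> f x" by (simp add: LIM_zero_iff)
    then show ?thesis
      using norm_limit_imp_pointwise[OF s g lim] LIMSEQ_unique by blast
  qed
  then have "g = f" by auto
  have "ip_norm ip f \<le> ip_norm ip (s n - g) + C" for n
    using norm_diff_triangle[OF f s zero_in, of n] norm_minus_commute[OF f s, of n]
      bound[OF F, of n] \<open>g = f\<close> by (simp add: s_def S_def)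
  then show ?thesis
    using LIMSEQ_le_const[OF tendsto_add[OF lim tendsto_const[of C]], of "ip_norm ip f"] by auto
qed

end

text \<open>
  By Cauchy--Schwarz, \<open>f\<close> inherits boundedness and continuity from the features: their norms are
  bounded, and \<open>d y\<close>, the distance of the features at \<open>y\<close> and \<open>x\<close>, is a continuous expression in the
  kernel.
\<close>

lemma native_in_bcontfun:
  fixes f :: "'x::topological_space \<Rightarrow> real"
  assumes "native_space H ip k" and f: "f \<in> H"
    and cont: "continuous_on UNIV (\<lambda>(x, x'). k x x')"
    and bdd: "bounded (range (\<lambda>(x, x'). k x x'))"
  shows "f \<in> bcontfun"
proof -
  interpret native_space H ip k by fact
  obtain B where B: "\<And>x y. \<bar>k x y\<bar> \<le> B"
    using bdd by (auto simp: bounded_iff)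
  show ?thesis
  proof (rule bcontfun_normI)
    fix x
    have "\<bar>f x\<bar> \<le> ip_norm ip f * sqrt (k x x)" using f by (rule eval_le)
    also have "\<dots> \<le> ip_norm ip f * sqrt B"
      using B[of x x] norm_nonneg[OF f] by (intro mult_left_mono) auto
    finally show "norm (f x) \<le> ip_norm ip f * sqrt B" by simp
  next
    have "(f \<longlongrightarrow> f x) (at x)" for x
    proof -
      define d where "d y = sqrt (k y y - 2 * k x y + k x x)" for y
      have k_cont: "continuous_on UNIV (\<lambda>y. k (g y) (h y))"
        if "continuous_on UNIV g" "continuous_on UNIV h" for g h :: "'x \<Rightarrow> 'x"
        using continuous_on_compose2[OF cont continuous_on_Pair[OF that]] by simp
      have "continuous_on UNIV d"
        unfolding d_def by (intro continuous_intros k_cont)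
      then have "(d \<longlongrightarrow> d x) (at x)" by (simp add: continuous_on_def)
      then have lim: "((\<lambda>y. ip_norm ip f * d y) \<longlongrightarrow> 0) (at x)"
        using tendsto_mult_left[of d "d x" "at x" "ip_norm ip f"] by (simp add: d_def)
      have le: "norm (f y - f x) \<le> ip_norm ip f * d y" for y
      proof -
        have "ip_norm ip (k y - k x) = d y"
          using ip_commute[OF feature_mem feature_mem, of y x]
          by (simp add: ip_norm_def d_def ip_diff ip_diff_right feature_mem diff_in ip_features)
        then show ?thesis
          using Cauchy_Schwarz[OF f diff_in[OF feature_mem feature_mem], of y x] f
          by (simp add: ip_diff_right feature_mem reproducing[OF f])
      qed
      have "((\<lambda>y. f y - f x) \<longlongrightarrow> 0) (at x)"
        by (rule Lim_null_comparison[OF _ lim]) (intro always_eventually allI le)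
      then show ?thesis by (simp add: LIM_zero_iff)
    qed
    then show "continuous_on UNIV f" by (simp add: continuous_on_def)
  qed
qed

section \<open>Supremum and operator norms\<close>

lemma abs_le_sup_norm: "f \<in> bcontfun \<Longrightarrow> \<bar>f x\<bar> \<le> sup_norm f"
  using norm_bounded[of "Bcontfun f" x] by (simp add: sup_norm_def Bcontfun_inverse)

lemma sup_norm_le: "f \<in> bcontfun \<Longrightarrow> (\<And>x. \<bar>f x\<bar> \<le> b) \<Longrightarrow> sup_norm f \<le> b"
  using norm_bound[of "Bcontfun f" b] by (simp add: sup_norm_def Bcontfun_inverse)

lemma sup_norm_nonneg: "0 \<le> sup_norm f"
  by (simp add: sup_norm_def)

lemma sup_norm_scale:
  assumes "f \<in> bcontfun" shows "sup_norm (\<lambda>x. c * f x) = \<bar>c\<bar> * sup_norm f"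
proof -
  have "(\<lambda>x. c * f x) \<in> bcontfun" using scaleR_cont[OF assms, of c] by simp
  then have "Bcontfun (\<lambda>x. c * f x) = c *\<^sub>R Bcontfun f"
    using assms by (intro bcontfun_eqI) (simp add: Bcontfun_inverse)
  then show ?thesis by (simp add: sup_norm_def)
qed

lemma sup_norm_add:
  assumes "f \<in> bcontfun" "g \<in> bcontfun"
  shows "sup_norm (\<lambda>x. f x + g x) \<le> sup_norm f + sup_norm g"
  using assms
  by (intro sup_norm_le plus_cont)
    (auto intro: order.trans[OF abs_triangle_ineq] add_mono abs_le_sup_norm)

lemma op_norm_le:
  assumes "g \<in> E" "nE g \<le> 1" and "\<And>f. f \<in> E \<Longrightarrow> nE f \<le> 1 \<Longrightarrow> nF (T f) \<le> C"
  shows "op_norm E nE nF T \<le> C"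
  unfolding op_norm_def using assms by (intro cSUP_least) auto

text \<open>
  The supremum in the operator norm is one of real numbers, hence the bound \<open>C\<close>: it makes the
  supremum genuine.  It also settles the case \<open>nE f = 0\<close>, where \<open>f\<close> cannot be normalised.
\<close>

lemma
  fixes E :: "('a \<Rightarrow> real) set"
  assumes scale_E: "\<And>c f. f \<in> E \<Longrightarrow> (\<lambda>x. c * f x) \<in> E"
    and nE_nonneg: "\<And>f. f \<in> E \<Longrightarrow> 0 \<le> nE f"
    and nE_scale: "\<And>c f. f \<in> E \<Longrightarrow> nE (\<lambda>x. c * f x) = \<bar>c\<bar> * nE f"
    and nF_nonneg: "\<And>f. f \<in> E \<Longrightarrow> 0 \<le> nF (T f)"
    and T_scale: "\<And>c f. f \<in> E \<Longrightarrow> nF (T (\<lambda>x. c * f x)) = \<bar>c\<bar> * nF (T f)"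
    and bound: "\<And>f. f \<in> E \<Longrightarrow> nF (T f) \<le> C * nE f"
    and f: "f \<in> E"
  shows op_norm_bound: "nF (T f) \<le> op_norm E nE nF T * nE f"
    and op_norm_nonneg: "0 \<le> op_norm E nE nF T"
proof -
  have "nF (T g) \<le> \<bar>C\<bar>" if "g \<in> E" "nE g \<le> 1" for g
  proof -
    have "C * nE g \<le> \<bar>C\<bar> * 1"
      using that nE_nonneg by (intro mult_mono) auto
    with bound[OF that(1)] show ?thesis by linarith
  qed
  then have "bdd_above ((\<lambda>f. nF (T f)) ` {f \<in> E. nE f \<le> 1})"
    by (auto simp: bdd_above_def)
  then have upper: "nF (T g) \<le> op_norm E nE nF T" if "g \<in> E" "nE g \<le> 1" for g
    unfolding op_norm_def using that by (intro cSUP_upper) auto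
  show "nF (T f) \<le> op_norm E nE nF T * nE f"
  proof (cases "nE f = 0")
    case True
    then show ?thesis using bound[OF f] by simp
  next
    case False
    then have pos: "0 < nE f" using nE_nonneg[OF f] by simp
    have "nF (T (\<lambda>x. inverse (nE f) * f x)) \<le> op_norm E nE nF T"
      using f pos by (intro upper scale_E) (simp_all add: nE_scale)
    then have "inverse (nE f) * nF (T f) \<le> op_norm E nE nF T"
      unfolding T_scale[OF f] using pos by simp
    then show ?thesis using pos by (simp add: field_simps)
  qed
  have "0 \<le> nF (T (\<lambda>x. 0 * f x))"
    by (intro nF_nonneg scale_E f)
  also have "\<dots> \<le> op_norm E nE nF T"
    using nE_scale[OF f, of 0] by (intro upper scale_E f) simp
  finally show "0 \<le> op_norm E nE nF T" .
qed

section \<open>Boundedness of the Koopman operator\<close>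

lemma koopman_scale: "koopman A (\<lambda>y. c * f y) = (\<lambda>x. c * koopman A f x)"
  by (simp add: koopman_def comp_def)

text \<open>
  A closed graph theorem for composition operators.  On a combination \<open>v\<close> of features of \<open>X\<close> the
  transpose acts explicitly: \<open>\<langle>f \<circ> A, v\<rangle> = \<langle>f, v'\<rangle>\<close>, where \<open>v'\<close> has the same coefficients, with the
  features moved by \<open>A\<close>.  For \<open>v\<close> in the unit ball the functions \<open>v'\<close> are weakly bounded, as
  \<open>f \<circ> A\<close> lies in \<open>NX\<close>, so they are bounded.  Applying this to the projections \<open>v\<close> of \<open>f \<circ> A\<close>
  bounds them uniformly, and hence bounds \<open>f \<circ> A\<close>.
\<close>

lemma koopman_bounded:
  assumes "native_space NX ipX kX" "native_space NY ipY kY" and incl: "koopman A ` NY \<subseteq> NX"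
  shows "\<exists>C. \<forall>f\<in>NY. ip_norm ipX (koopman A f) \<le> C * ip_norm ipY f"
proof -
  interpret X: native_space NX ipX kX by fact
  interpret Y: native_space NY ipY kY by fact
  have KX: "koopman A f \<in> NX" if "f \<in> NY" for f using incl that by blast
  define v where "v F c = (\<lambda>z. \<Sum>x\<in>F. c x * kX x z)" for F c
  define v' where "v' F c = (\<lambda>z. \<Sum>x\<in>F. c x * kY (A x) z)" for F c
  have v: "v F c \<in> NX" "v' F c \<in> NY" for F c
    by (auto simp: v_def v'_def intro!: X.lincomb_in Y.lincomb_in X.feature_mem Y.feature_mem)
  have transpose: "ipX (koopman A f) (v F c) = ipY f (v' F c)" if "f \<in> NY" for f F c
    using KX[OF that] that X.reproducing[OF KX[OF that]] Y.reproducing[OF that]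
    by (simp add: v_def v'_def X.ip_lincomb_right Y.ip_lincomb_right X.feature_mem Y.feature_mem)
      (simp add: koopman_def)
  have v_scale: "v F (\<lambda>x. a * c x) = (\<lambda>z. a * v F c z)"
    "v' F (\<lambda>x. a * c x) = (\<lambda>z. a * v' F c z)" for F c a
    by (simp_all add: v_def v'_def sum_distrib_left mult.assoc)
  define W where "W = {v' F c | F c. ip_norm ipX (v F c) \<le> 1}"
  have "\<exists>C. \<forall>w\<in>W. ip_norm ipY w \<le> C"
  proof (rule Y.weakly_bounded_imp_bounded)
    show "W \<subseteq> NY" using v by (auto simp: W_def)
    fix f assume f: "f \<in> NY"
    have "\<bar>ipY f (v' F c)\<bar> \<le> ip_norm ipX (koopman A f)" if "ip_norm ipX (v F c) \<le> 1" for F c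
    proof -
      have "\<bar>ipY f (v' F c)\<bar> \<le> ip_norm ipX (koopman A f) * ip_norm ipX (v F c)"
        using X.Cauchy_Schwarz[OF KX[OF f] v(1)] transpose[OF f] by metis
      also have "\<dots> \<le> ip_norm ipX (koopman A f)"
        using that X.norm_nonneg[OF KX[OF f]] by (rule mult_left_le)
      finally show ?thesis .
    qed
    then show "\<exists>C. \<forall>w\<in>W. \<bar>ipY f w\<bar> \<le> C" by (auto simp: W_def)
  qed
  then obtain C where C: "\<And>F c. ip_norm ipX (v F c) \<le> 1 \<Longrightarrow> ip_norm ipY (v' F c) \<le> C"
    by (auto simp: W_def)
  have "ip_norm ipX (koopman A f) \<le> C * ip_norm ipY f" if f: "f \<in> NY" for f
  proof (rule X.norm_le_if_proj_norm_le[OF KX[OF f]])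
    fix F :: "'a set" assume F: "finite F"
    let ?s = "native_proj ipX kX F (koopman A f)"
    note s = X.native_proj_in_span[OF F KX[OF f]] X.native_proj_in[OF F KX[OF f]]
      X.native_proj_eq_on[OF F KX[OF f]]
    obtain c where c: "?s = v F c" using s(1) by (auto simp: feature_span_def v_def)
    show "ip_norm ipX ?s \<le> C * ip_norm ipY f"
    proof (cases "?s = 0")
      case True
      have "0 \<le> C"
        using C[of "{}" undefined] X.norm_zero Y.norm_zero
        by (simp add: v_def v'_def zero_fun_def)
      then show ?thesis using True Y.norm_nonneg[OF f] X.norm_zero by simp
    next
      case False
      define a where "a = inverse (ip_norm ipX ?s)"
      have pos: "0 < ip_norm ipX ?s"
        using False s X.norm_nonneg X.norm_eq_0_iff by (metis less_eq_real_def)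
      then have a: "0 \<le> a" "a * ip_norm ipX ?s = 1" by (auto simp: a_def)
      have "ip_norm ipX (v F (\<lambda>x. a * c x)) \<le> 1"
        using a by (simp add: v_scale X.norm_scale[OF s(2)] flip: c)
      then have "ip_norm ipY (v' F (\<lambda>x. a * c x)) \<le> C" by (rule C)
      then have "a * ip_norm ipY (v' F c) \<le> C"
        using a(1) by (simp add: v_scale Y.norm_scale[OF v(2)])
      from mult_right_mono[OF this, of "ip_norm ipX ?s"]
      have v'_le: "ip_norm ipY (v' F c) \<le> C * ip_norm ipX ?s"
        using pos a(2) by (simp add: mult.assoc mult.left_commute[of a])
      have "ipX (koopman A f - ?s) ?s = 0"
        using s KX[OF f] by (intro X.vanish_imp_orthogonal[of _ F]) (auto simp: X.diff_in)
      then have "(ip_norm ipX ?s)\<^sup>2 = ipX (koopman A f) ?s"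
        using s KX[OF f] by (simp add: X.ip_diff X.norm_sq)
      also have "\<dots> = ipY f (v' F c)" using transpose[OF f] c by simp
      also have "\<dots> \<le> ip_norm ipY f * ip_norm ipY (v' F c)"
        using Y.Cauchy_Schwarz[OF f v(2), of F c] by linarith
      also have "\<dots> \<le> ip_norm ipY f * (C * ip_norm ipX ?s)"
        using v'_le Y.norm_nonneg[OF f] by (rule mult_left_mono)
      finally have "ip_norm ipX ?s * ip_norm ipX ?s \<le> (C * ip_norm ipY f) * ip_norm ipX ?s"
        by (simp add: power2_eq_square mult_ac)
      then show ?thesis using pos by (rule mult_right_le_imp_le)
    qed
  qed
  then show ?thesis by blast
qed

section \<open>Error bounds for the Koopman approximants\<close>

text \<open>
  The residual has at most the native norm of \<open>f\<close>, and point evaluations are uniformly bounded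
  because the kernel is.  So the supremum that defines the operator norm of \<open>I - S\<close> is finite.
\<close>

lemma
  fixes f :: "'x::topological_space \<Rightarrow> real"
  assumes N: "native_space H ip k" and P: "finite P" and f: "f \<in> H"
    and cont: "continuous_on UNIV (\<lambda>(x, x'). k x x')"
    and bdd: "bounded (range (\<lambda>(x, x'). k x x'))"
  shows sup_norm_residual_le:
      "sup_norm (f - native_proj ip k P f)
        \<le> op_norm H (ip_norm ip) sup_norm (\<lambda>g. g - native_proj ip k P g) * ip_norm ip f"
    and op_norm_residual_nonneg:
      "0 \<le> op_norm H (ip_norm ip) sup_norm (\<lambda>g. g - native_proj ip k P g)"
proof -
  interpret native_space H ip k by fact
  let ?R = "\<lambda>g. g - native_proj ip k P g"
  obtain B where B: "\<And>x y. \<bar>k x y\<bar> \<le> B"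
    using bdd by (auto simp: bounded_iff)
  have R: "?R g \<in> H" "?R g \<in> bcontfun" if "g \<in> H" for g
    using that P N cont bdd by (auto intro: diff_in native_proj_in native_in_bcontfun)
  have bound: "sup_norm (?R g) \<le> sqrt B * ip_norm ip g" if g: "g \<in> H" for g
  proof (rule sup_norm_le[OF R(2)[OF g]])
    fix x
    have "\<bar>?R g x\<bar> \<le> ip_norm ip (?R g) * sqrt (k x x)"
      using R(1)[OF g] by (rule eval_le)
    also have "\<dots> \<le> ip_norm ip g * sqrt B"
    proof (rule mult_mono)
      show "sqrt (k x x) \<le> sqrt B" using B[of x x] by simp
      show "0 \<le> sqrt (k x x)" using norm_nonneg[OF feature_mem, of x] by (simp add: norm_kernel)
    qed (use norm_proj_residual_le[OF P g] norm_nonneg[OF g] in auto)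
    finally show "\<bar>?R g x\<bar> \<le> sqrt B * ip_norm ip g" by (simp add: mult.commute)
  qed
  have scale: "sup_norm (?R (\<lambda>x. c * g x)) = \<bar>c\<bar> * sup_norm (?R g)" if g: "g \<in> H" for c g
  proof -
    have "?R (\<lambda>x. c * g x) = (\<lambda>x. c * ?R g x)"
      using native_proj_scale[OF P g, of c] by (simp add: fun_eq_iff right_diff_distrib)
    then show ?thesis using sup_norm_scale[OF R(2)[OF g]] by simp
  qed
  show "sup_norm (?R f) \<le> op_norm H (ip_norm ip) sup_norm ?R * ip_norm ip f"
    by (rule op_norm_bound[where E = H and nE = "ip_norm ip" and C = "sqrt B"])
      (erule scale_mem norm_nonneg norm_scale scale bound | rule sup_norm_nonneg f)+
  show "0 \<le> op_norm H (ip_norm ip) sup_norm ?R"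
    by (rule op_norm_nonneg[where E = H and nE = "ip_norm ip" and C = "sqrt B"])
      (erule scale_mem norm_nonneg norm_scale scale bound | rule sup_norm_nonneg f)+
qed

text \<open>
  The domain \<open>E\<close> covers both operator norms of \<open>koopman A\<close> that occur: on the whole native space and
  on a span of features.
\<close>

lemma
  assumes X: "native_space NX ipX kX" and Y: "native_space NY ipY kY"
    and incl: "koopman A ` NY \<subseteq> NX"
    and E: "E \<subseteq> NY" "\<And>c f. f \<in> E \<Longrightarrow> (\<lambda>y. c * f y) \<in> E" and f: "f \<in> E"
  shows norm_koopman_le: "ip_norm ipX (koopman A f)
      \<le> op_norm E (ip_norm ipY) (ip_norm ipX) (koopman A) * ip_norm ipY f"
    and op_norm_koopman_nonneg: "0 \<le> op_norm E (ip_norm ipY) (ip_norm ipX) (koopman A)"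
proof -
  interpret X: native_space NX ipX kX by fact
  interpret Y: native_space NY ipY kY by fact
  obtain C where C: "\<And>f. f \<in> NY \<Longrightarrow> ip_norm ipX (koopman A f) \<le> C * ip_norm ipY f"
    using koopman_bounded[OF X Y incl] by blast
  have in_NY: "g \<in> NY" and in_NX: "koopman A g \<in> NX" if "g \<in> E" for g
    using that E(1) incl by auto
  have prems: "0 \<le> ip_norm ipY g" "ip_norm ipY (\<lambda>y. c * g y) = \<bar>c\<bar> * ip_norm ipY g"
    "0 \<le> ip_norm ipX (koopman A g)" "ip_norm ipX (koopman A g) \<le> C * ip_norm ipY g"
    "ip_norm ipX (koopman A (\<lambda>y. c * g y)) = \<bar>c\<bar> * ip_norm ipX (koopman A g)"
    if g: "g \<in> E" for c g
    using C[OF in_NY[OF g]] X.norm_nonneg[OF in_NX[OF g]] X.norm_scale[OF in_NX[OF g]]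
      Y.norm_nonneg[OF in_NY[OF g]] Y.norm_scale[OF in_NY[OF g]]
    by (simp_all add: koopman_scale)
  show "ip_norm ipX (koopman A f)
      \<le> op_norm E (ip_norm ipY) (ip_norm ipX) (koopman A) * ip_norm ipY f"
    by (rule op_norm_bound[where E = E and nE = "ip_norm ipY" and C = C])
      (erule E(2) prems | rule f)+
  show "0 \<le> op_norm E (ip_norm ipY) (ip_norm ipX) (koopman A)"
    by (rule op_norm_nonneg[where E = E and nE = "ip_norm ipY" and C = C])
      (erule E(2) prems | rule f)+
qed

theorem theorem3p4:
  fixes A :: "'x::topological_space \<Rightarrow> 'y::topological_space"
    and kX :: "'x \<Rightarrow> 'x \<Rightarrow> real" and kY :: "'y \<Rightarrow> 'y \<Rightarrow> real"
    and NX :: "('x \<Rightarrow> real) set" and ipX :: "('x \<Rightarrow> real) \<Rightarrow> ('x \<Rightarrow> real) \<Rightarrow> real"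
    and NY :: "('y \<Rightarrow> real) set" and ipY :: "('y \<Rightarrow> real) \<Rightarrow> ('y \<Rightarrow> real) \<Rightarrow> real"
    and P :: "'x set" and Q :: "'y set"
  assumes "continuous_on UNIV A"
    and "continuous_on UNIV (\<lambda>(x, x'). kX x x')" and "bounded (range (\<lambda>(x, x'). kX x x'))"
    and "strictly_positive_definite kX"
    and "continuous_on UNIV (\<lambda>(y, y'). kY y y')" and "bounded (range (\<lambda>(y, y'). kY y y'))"
    and "strictly_positive_definite kY"
    and "native_space NX ipX kX" and "native_space NY ipY kY"
    and "finite P" and "finite Q"
    and "koopman A ` NY \<subseteq> NX"
  shows
    "op_norm NY (ip_norm ipY) sup_norm
         (\<lambda>f. koopman A f - koopman_approx A kX P ipY kY (A ` P) f)
       \<le> op_norm NX (ip_norm ipX) sup_norm (\<lambda>f. f - native_proj ipX kX P f)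
          * op_norm NY (ip_norm ipY) (ip_norm ipX) (koopman A)
     \<and> op_norm NY (ip_norm ipY) sup_norm
         (\<lambda>f. koopman A f - koopman_approx A kX P ipY kY Q f)
       \<le> op_norm NY (ip_norm ipY) sup_norm (\<lambda>f. f - native_proj ipY kY Q f)
          + op_norm NX (ip_norm ipX) sup_norm (\<lambda>f. f - native_proj ipX kX P f)
            * op_norm (feature_span kY Q) (ip_norm ipY) (ip_norm ipX) (koopman A)
     \<and> (\<forall>f\<in>NY.
         sup_norm (koopman A f - koopman_approx A kX P ipY kY (A ` P) f)
         \<le> op_norm NX (ip_norm ipX) sup_norm (\<lambda>g. g - native_proj ipX kX P g)
            * op_norm NY (ip_norm ipY) (ip_norm ipX) (koopman A) * ip_norm ipY f)
     \<and> (\<forall>f\<in>NY.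
         sup_norm (koopman A f - koopman_approx A kX P ipY kY Q f)
         \<le> sup_norm (f - native_proj ipY kY Q f)
            + op_norm NX (ip_norm ipX) sup_norm (\<lambda>g. g - native_proj ipX kX P g)
              * op_norm (feature_span kY Q) (ip_norm ipY) (ip_norm ipX) (koopman A)
              * ip_norm ipY (native_proj ipY kY Q f))"
proof -
  interpret X: native_space NX ipX kX by fact
  interpret Y: native_space NY ipY kY by fact
  let ?RX = "op_norm NX (ip_norm ipX) sup_norm (\<lambda>g. g - native_proj ipX kX P g)"
  let ?RY = "op_norm NY (ip_norm ipY) sup_norm (\<lambda>g. g - native_proj ipY kY Q g)"
  let ?K = "op_norm NY (ip_norm ipY) (ip_norm ipX) (koopman A)"
  let ?KQ = "op_norm (feature_span kY Q) (ip_norm ipY) (ip_norm ipX) (koopman A)"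
  let ?e = "\<lambda>Z f. koopman A f - koopman_approx A kX P ipY kY Z f"
  let ?SQ = "native_proj ipY kY Q"
  note RX_le = sup_norm_residual_le[OF assms(8,10) _ assms(2,3)]
  note RY_le = sup_norm_residual_le[OF assms(9,11) _ assms(5,6)]
  have RX: "0 \<le> ?RX" by (rule op_norm_residual_nonneg[OF assms(8,10) X.zero_in assms(2,3)])
  have K_le: "ip_norm ipX (koopman A f) \<le> ?K * ip_norm ipY f" and K: "0 \<le> ?K" if "f \<in> NY" for f
    using norm_koopman_le[OF assms(8,9,12) order_refl Y.scale_mem that]
      op_norm_koopman_nonneg[OF assms(8,9,12) order_refl Y.scale_mem that] by auto
  have span: "feature_span kY Q \<subseteq> NY" using Y.span_in by blast
  have KQ_le: "ip_norm ipX (koopman A f) \<le> ?KQ * ip_norm ipY f" and KQ: "0 \<le> ?KQ"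
    if "f \<in> feature_span kY Q" for f
    using norm_koopman_le[OF assms(8,9,12) span feature_span_scale that]
      op_norm_koopman_nonneg[OF assms(8,9,12) span feature_span_scale that] by auto
  have KX: "koopman A f \<in> NX" if "f \<in> NY" for f using assms(12) that by blast
  have bX: "f \<in> bcontfun" if "f \<in> NX" for f
    using native_in_bcontfun[OF assms(8) that assms(2,3)] .
  have bY: "f \<in> bcontfun" if "f \<in> NY" for f
    using native_in_bcontfun[OF assms(9) that assms(5,6)] .
  have first: "sup_norm (?e (A ` P) f) \<le> ?RX * ?K * ip_norm ipY f" if f: "f \<in> NY" for f
  proof -
    have fin: "finite (A ` P)" using assms(10) by simp
    \<comment> \<open>Projecting at \<open>A ` P\<close> does not change the values that are interpolated on \<open>P\<close>.\<close>
    have "koopman_approx A kX P ipY kY (A ` P) f = interpolant kX P (koopman A f)"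
      unfolding koopman_approx_def
      using X.interpolant_spec[OF assms(10) KX[OF f]] Y.native_proj_eq_on[OF fin f]
      by (intro X.interpolant_eqI) (auto simp: koopman_def)
    also have "\<dots> = native_proj ipX kX P (koopman A f)"
      by (simp add: X.native_proj_eq_interpolant assms(10) KX[OF f])
    finally have "sup_norm (?e (A ` P) f) \<le> ?RX * ip_norm ipX (koopman A f)"
      using RX_le[OF KX[OF f]] by simp
    also have "\<dots> \<le> ?RX * (?K * ip_norm ipY f)"
      using K_le[OF f] RX by (rule mult_left_mono)
    finally show ?thesis by (simp add: mult.assoc)
  qed
  have second: "sup_norm (?e Q f)
      \<le> sup_norm (f - ?SQ f) + ?RX * ?KQ * ip_norm ipY (?SQ f)" if f: "f \<in> NY" for f
  proof -
    let ?s = "?SQ f"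
    have s: "?s \<in> feature_span kY Q" "?s \<in> NY"
      using Y.native_proj_in_span[OF assms(11) f] Y.native_proj_in[OF assms(11) f] .
    let ?u = "koopman A (f - ?s)" and ?r = "koopman A ?s - native_proj ipX kX P (koopman A ?s)"
    have d: "f - ?s \<in> NY" using f s by (simp add: Y.diff_in)
    have "koopman_approx A kX P ipY kY Q f = native_proj ipX kX P (koopman A ?s)"
      unfolding koopman_approx_def
      by (simp add: X.native_proj_eq_interpolant assms(10) KX[OF s(2)])
    \<comment> \<open>The part of \<open>f\<close> lost in \<open>Y\<close> is measured in the supremum norm only, where composition with
      \<open>A\<close> costs nothing; the projected part stays in the native spaces.\<close>
    then have split: "?e Q f = (\<lambda>x. ?u x + ?r x)"
      by (simp add: koopman_def fun_eq_iff)
    have "?r \<in> NX"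
      using KX[OF s(2)] assms(10) by (intro X.diff_in X.native_proj_in)
    then have "sup_norm (?e Q f) \<le> sup_norm ?u + sup_norm ?r"
      unfolding split by (intro sup_norm_add bX KX d)
    moreover have "sup_norm ?u \<le> sup_norm (f - ?s)"
      using abs_le_sup_norm[OF bY[OF d]]
      by (intro sup_norm_le bX KX d) (simp add: koopman_def)
    moreover have "sup_norm ?r \<le> ?RX * (?KQ * ip_norm ipY ?s)"
      using RX_le[OF KX[OF s(2)]] mult_left_mono[OF KQ_le[OF s(1)] RX] by linarith
    ultimately show ?thesis by (simp add: mult.assoc)
  qed
  have "op_norm NY (ip_norm ipY) sup_norm (?e (A ` P)) \<le> ?RX * ?K"
  proof (rule op_norm_le[of 0])
    fix f assume f: "f \<in> NY" "ip_norm ipY f \<le> 1"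
    have "?RX * ?K * ip_norm ipY f \<le> ?RX * ?K"
      using f RX K[OF f(1)] by (intro mult_left_le) auto
    with first[OF f(1)] show "sup_norm (?e (A ` P) f) \<le> ?RX * ?K" by linarith
  qed (simp_all add: Y.zero_in Y.norm_zero)
  moreover have "op_norm NY (ip_norm ipY) sup_norm (?e Q) \<le> ?RY + ?RX * ?KQ"
  proof (rule op_norm_le[of 0])
    fix f assume f: "f \<in> NY" "ip_norm ipY f \<le> 1"
    note s = Y.native_proj_in_span[OF assms(11) f(1)]
    have "sup_norm (f - ?SQ f) \<le> ?RY"
      using RY_le[OF f(1)] f(2) mult_left_le[OF f(2)]
        op_norm_residual_nonneg[OF assms(9,11) f(1) assms(5,6)] by (meson order.trans)
    moreover have "?RX * ?KQ * ip_norm ipY (?SQ f) \<le> ?RX * ?KQ"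
      using Y.norm_proj_le[OF assms(11) f(1)] f(2) RX KQ[OF s] by (intro mult_left_le) auto
    ultimately show "sup_norm (?e Q f) \<le> ?RY + ?RX * ?KQ"
      using second[OF f(1)] by linarith
  qed (simp_all add: Y.zero_in Y.norm_zero)
  ultimately show ?thesis using first second by blast
qed

end
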